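(* Fix a period $t$. Consider the Lagrangian dual problem (d-UC) of the single-period security constrained unit commitment problem, $$\max_{\boldsymbol{\lambda}_t}\ \Phi_t(\boldsymbol{\lambda}_t)\quad\text{s.t.}\quad \lambda_{l,t}^+,\lambda_{l,t}^-\ge 0\ \ \forall l,$$ and the linear program (d-UC-LP) in the variables $\boldsymbol{\lambda}_t$ and $y_t=(y_{i,t})_i$, $$\max_{\boldsymbol{\lambda}_t,\,y_t}\ \sum_i y_{i,t}+\lambda_{0,t}\sum_k d_{k,t}+\sum_l(\lambda_{l,t}^+g_{l,t}^++\lambda_{l,t}^-g_{l,t}^-)$$ subject to $$\lambda_{l,t}^+,\lambda_{l,t}^-\ge0\ \ \forall l,\qquad y_{i,t}\le 0,\quad y_{i,t}\le[a_i+\beta_{i,t}(\boldsymbol{\lambda}_t)]\overline{P}_i+b_i,\quad y_{i,t}\le[a_i+\beta_{i,t}(\boldsymbol{\lambda}_t)]\underline{P}_i+b_i\ \ \forall i.$$ Then d-UC and d-UC-LP are equivalent: they have the same optimal value (supremum), and $\boldsymbol{\lambda}_t$ is an optimal solution of d-UC if and only if there is $y_t$ such that $(\boldsymbol{\lambda}_t,y_t)$ is an optimal solution of d-UC-LP. Moreover, if $(\tilde{\boldsymbol{\lambda}}_t,\tilde y_t)$ is an optimal solution of d-UC-LP, then for each unit $i$ the value $\tilde z_{i,t}=0$ if $\tilde y_{i,t}=0$, and $\tilde z_{i,t}=1$ otherwise, is an optimal commitment decision (i.e. the $z$-component of some optimal solution) of the individual-unit subproblem $$\min_{p_{i,t},\,z_{i,t}}\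 C_i(p_{i,t},z_{i,t})+\beta_{i,t}(\tilde{\boldsymbol{\lambda}}_t)p_{i,t}\quad\text{s.t.}\quad z_{i,t}\underline{P}_i\le p_{i,t}\le z_{i,t}\overline{P}_i,\ z_{i,t}\in\{0,1\}.$$
   Context: Indices $i$ (units), $k$ (loads), $l$ (transmission constraints) range over finite sets. Given real data: cost coefficients $a_i,b_i$; capacities $0\le\underline{P}_i\le\overline{P}_i$; loads $d_{k,t}$; transmission limits $F_l$; factors $\Gamma^U_{l,i},\Gamma^D_{l,k}$. The fuel cost is $C_i(p,0)=0$, $C_i(p,1)=a_ip+b_i$. The single-period problem (s-UC) is: minimize $\sum_iC_i(p_{i,t},z_{i,t})$ over $p_t=(p_{i,t})_i$ real and $z_t=(z_{i,t})_i$ binary, subject to $\sum_ip_{i,t}-\sum_kd_{k,t}=0$; $\sum_i\Gamma^U_{l,i}p_{i,t}-\sum_k\Gamma^D_{l,k}d_{k,t}\le F_l$ and $-\sum_i\Gamma^U_{l,i}p_{i,t}+\sum_k\Gamma^D_{l,k}d_{k,t}\le F_l$ for all $l$; and $z_{i,t}\underline{P}_i\le p_{i,t}\le z_{i,t}\overline{P}_i$ for all $i$. The multipliers are $\boldsymbol{\lambda}_t=(\lambda_{0,t},(\lambda_{l,t}^+)_l,(\lambda_{l,t}^-)_l)$, with $\lambda_{0,t}\in\mathbb{R}$ unrestricted in sign. The Lagrangian is $$L_t(\boldsymbol{\lambda}_t,p_t,z_t)=\sum_iC_i(p_{i,t},z_{i,t})+\lambda_{0,t}\Bigl(\sum_kd_{k,t}-\sum_ip_{i,t}\Bigr)+\sum_l\lambda_{l,t}^+\Bigl(\sum_i\Gamma^U_{l,i}p_{i,t}-\sum_k\Gamma^D_{l,k}d_{k,t}-F_l\Bigr)-\sum_l\lambda_{l,t}^-\Bigl(\sum_i\Gamma^U_{l,i}p_{i,t}-\sum_k\Gamma^D_{l,k}d_{k,t}+F_l\Bigr),$$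 and the dual function is $\Phi_t(\boldsymbol{\lambda}_t)=\min_{p_t,z_t}L_t(\boldsymbol{\lambda}_t,p_t,z_t)$ subject to $z_{i,t}\underline{P}_i\le p_{i,t}\le z_{i,t}\overline{P}_i$ and $z_{i,t}\in\{0,1\}$ for all $i$. Further notation: $\beta_{i,t}(\boldsymbol{\lambda}_t)=-\lambda_{0,t}+\sum_l(\lambda_{l,t}^+-\lambda_{l,t}^-)\Gamma^U_{l,i}$, $g_{l,t}^+=-\sum_k\Gamma^D_{l,k}d_{k,t}-F_l$, and $g_{l,t}^-=\sum_k\Gamma^D_{l,k}d_{k,t}-F_l$. *)

theory Defs
  imports "HOL-Analysis.Analysis"
begin

(* The index sets are explicit carriers, so each of them may be empty; values of the data and of
   the variables at indices outside the carriers never enter an objective or a constraint. *)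
record ('i, 'k, 'l, 't) uc_data =
  units :: "'i set"
  loads :: "'k set"
  lines :: "'l set"
  cost_a :: "'i \<Rightarrow> real"
  cost_b :: "'i \<Rightarrow> real"
  Pmin :: "'i \<Rightarrow> real"
  Pmax :: "'i \<Rightarrow> real"
  load :: "'k \<Rightarrow> 't \<Rightarrow> real"
  Flim :: "'l \<Rightarrow> real"
  GammaU :: "'l \<Rightarrow> 'i \<Rightarrow> real"
  GammaD :: "'l \<Rightarrow> 'k \<Rightarrow> real"

record 'l multipliers =
  lam0 :: real
  lam_plus :: "'l \<Rightarrow> real"
  lam_minus :: "'l \<Rightarrow> real"

(* Only evaluated at z = 0 and z = 1. *)
definition fuel_cost :: "('i, 'k, 'l, 't) uc_data \<Rightarrow> 'i \<Rightarrow> real \<Rightarrow> real \<Rightarrow> real" where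
  "fuel_cost D i p z = (if z = 0 then 0 else cost_a D i * p + cost_b D i)"

definition unit_feasible :: "('i, 'k, 'l, 't) uc_data \<Rightarrow> 'i \<Rightarrow> real \<Rightarrow> real \<Rightarrow> bool" where
  "unit_feasible D i p z \<longleftrightarrow> z * Pmin D i \<le> p \<and> p \<le> z * Pmax D i \<and> z \<in> {0, 1}"

definition total_load :: "('i, 'k, 'l, 't) uc_data \<Rightarrow> 't \<Rightarrow> real" where
  "total_load D t = (\<Sum>k\<in>loads D. load D k t)"

definition lagrangian ::
  "('i, 'k, 'l, 't) uc_data \<Rightarrow> 't \<Rightarrow> 'l multipliers \<Rightarrow> ('i \<Rightarrow> real) \<Rightarrow> ('i \<Rightarrow> real) \<Rightarrow> real" where
  "lagrangian D t lam p z =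
     (\<Sum>i\<in>units D. fuel_cost D i (p i) (z i))
     + lam0 lam * (total_load D t - (\<Sum>i\<in>units D. p i))
     + (\<Sum>l\<in>lines D. lam_plus lam l *
          ((\<Sum>i\<in>units D. GammaU D l i * p i) - (\<Sum>k\<in>loads D. GammaD D l k * load D k t) - Flim D l))
     - (\<Sum>l\<in>lines D. lam_minus lam l *
          ((\<Sum>i\<in>units D. GammaU D l i * p i) - (\<Sum>k\<in>loads D. GammaD D l k * load D k t) + Flim D l))"

(* The minimum of the Lagrangian, written as an infimum of extended reals, so that no
   boundedness condition is hidden in the definition. *)
definition dual_fun :: "('i, 'k, 'l, 't) uc_data \<Rightarrow> 't \<Rightarrow> 'l multipliers \<Rightarrow> ereal" where
  "dual_fun D t lam =
     (INF (p, z)\<in>{(p, z). \<forall>i\<in>units D. unit_feasible D i (p i) (z i)}.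
        ereal (lagrangian D t lam p z))"

definition dual_feasible :: "('i, 'k, 'l, 't) uc_data \<Rightarrow> 'l multipliers \<Rightarrow> bool" where
  "dual_feasible D lam \<longleftrightarrow> (\<forall>l\<in>lines D. 0 \<le> lam_plus lam l \<and> 0 \<le> lam_minus lam l)"

definition beta :: "('i, 'k, 'l, 't) uc_data \<Rightarrow> 'l multipliers \<Rightarrow> 'i \<Rightarrow> real" where
  "beta D lam i =
     - lam0 lam + (\<Sum>l\<in>lines D. (lam_plus lam l - lam_minus lam l) * GammaU D l i)"

definition g_plus :: "('i, 'k, 'l, 't) uc_data \<Rightarrow> 't \<Rightarrow> 'l \<Rightarrow> real" where
  "g_plus D t l = - (\<Sum>k\<in>loads D. GammaD D l k * load D k t) - Flim D l"

definition g_minus :: "('i, 'k, 'l, 't) uc_data \<Rightarrow> 't \<Rightarrow> 'l \<Rightarrow> real" where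
  "g_minus D t l = (\<Sum>k\<in>loads D. GammaD D l k * load D k t) - Flim D l"

definition lp_objective ::
  "('i, 'k, 'l, 't) uc_data \<Rightarrow> 't \<Rightarrow> 'l multipliers \<times> ('i \<Rightarrow> real) \<Rightarrow> real" where
  "lp_objective D t = (\<lambda>(lam, y).
     (\<Sum>i\<in>units D. y i) + lam0 lam * total_load D t
     + (\<Sum>l\<in>lines D. lam_plus lam l * g_plus D t l + lam_minus lam l * g_minus D t l))"

definition lp_feasible ::
  "('i, 'k, 'l, 't) uc_data \<Rightarrow> 'l multipliers \<times> ('i \<Rightarrow> real) \<Rightarrow> bool" where
  "lp_feasible D = (\<lambda>(lam, y).
     (\<forall>l\<in>lines D. 0 \<le> lam_plus lam l \<and> 0 \<le> lam_minus lam l) \<and>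
     (\<forall>i\<in>units D. y i \<le> 0 \<and>
        y i \<le> (cost_a D i + beta D lam i) * Pmax D i + cost_b D i \<and>
        y i \<le> (cost_a D i + beta D lam i) * Pmin D i + cost_b D i))"

definition subproblem_objective ::
  "('i, 'k, 'l, 't) uc_data \<Rightarrow> 'l multipliers \<Rightarrow> 'i \<Rightarrow> real \<times> real \<Rightarrow> real" where
  "subproblem_objective D lam i = (\<lambda>(p, z). fuel_cost D i p z + beta D lam i * p)"

definition optimal_commitment ::
  "('i, 'k, 'l, 't) uc_data \<Rightarrow> 'l multipliers \<Rightarrow> 'i \<Rightarrow> real \<Rightarrow> bool" where
  "optimal_commitment D lam i z \<longleftrightarrow>
     (\<exists>p. is_arg_min (subproblem_objective D lam i) (\<lambda>(p, z). unit_feasible D i p z) (p, z))"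

end

(* For fixed multipliers the Lagrangian separates over the units, and each unit's cost is affine in
   p once z is fixed, so the subproblem value is the minimum over the three points (0, 0),
   (Pmin, 1), (Pmax, 1). The dual function is therefore the LP objective evaluated at the largest
   feasible y, and optimality in the LP forces y to be this largest vector. *)
theory Submission
  imports Defs
begin

text \<open>This one number plays two roles: it is the largest \<open>y i\<close> that the LP
  constraints of unit \<open>i\<close> admit, and, when \<open>Pmin D i \<le> Pmax D i\<close>, the
  optimal value of that unit's subproblem.\<close>

definition unit_value :: "('i, 'k, 'l, 't) uc_data \<Rightarrow> 'l multipliers \<Rightarrow> 'i \<Rightarrow> real" where
  "unit_value D lam i =
     min 0 (min ((cost_a D i + beta D lam i) * Pmax D i + cost_b D i)
                ((cost_a D i + beta D lam i) * Pmin D i + cost_b D i))"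

lemma lp_feasible_iff:
  "lp_feasible D (lam, y) \<longleftrightarrow>
     dual_feasible D lam \<and> (\<forall>i\<in>units D. y i \<le> unit_value D lam i)"
  by (auto simp: lp_feasible_def dual_feasible_def unit_value_def)

text \<open>The sign of the slope \<open>c\<close> decides which endpoint gives the bound: the left
  one for \<open>c \<ge> 0\<close>, the right one otherwise.\<close>

lemma affine_ge_min_endpoints:
  fixes c l u p :: real
  assumes "l \<le> p" "p \<le> u"
  shows "min (c * u) (c * l) \<le> c * p"
proof (cases "0 \<le> c")
  case True
  then show ?thesis using mult_left_mono[OF assms(1), of c] by linarith
next
  case False
  then show ?thesis using mult_left_mono_neg[OF assms(2), of c] by linarith
qed

lemma unit_value_le:
  assumes "unit_feasible D i p z"
  shows "unit_value D lam i \<le> subproblem_objective D lam i (p, z)"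
proof -
  consider "z = 0" "p = 0" | "z = 1" "Pmin D i \<le> p" "p \<le> Pmax D i"
    using assms by (auto simp: unit_feasible_def)
  then show ?thesis
  proof cases
    case 1
    then show ?thesis by (simp add: unit_value_def subproblem_objective_def fuel_cost_def)
  next
    case 2
    show ?thesis
      using affine_ge_min_endpoints[OF 2(2,3), of "cost_a D i + beta D lam i"] 2(1)
      by (simp add: unit_value_def subproblem_objective_def fuel_cost_def distrib_right)
  qed
qed

text \<open>The commitment is prescribed by the zero test, in the form in which the final claim
  reads it off \<open>y\<close>. If the value is 0, switching off attains it, even when running
  would tie; otherwise the minimum is one of the two endpoint terms, so that endpoint with
  \<open>z = 1\<close> attains it.\<close>

lemma unit_value_attained:
  assumes "Pmin D i \<le> Pmax D i"
  obtains p where "unit_feasible D i p (if unit_value D lam i = 0 then 0 else 1)"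
    and "subproblem_objective D lam i (p, if unit_value D lam i = 0 then 0 else 1)
           = unit_value D lam i"
proof (cases "unit_value D lam i = 0")
  case True
  then show ?thesis
    by (intro that[of 0]) (auto simp: unit_feasible_def subproblem_objective_def fuel_cost_def)
next
  case False
  then consider
      "unit_value D lam i = (cost_a D i + beta D lam i) * Pmax D i + cost_b D i"
    | "unit_value D lam i = (cost_a D i + beta D lam i) * Pmin D i + cost_b D i"
    unfolding unit_value_def by linarith
  then show ?thesis
  proof cases
    case 1
    then show ?thesis
      using False assms
      by (intro that[of "Pmax D i"])
         (auto simp: unit_feasible_def subproblem_objective_def fuel_cost_def distrib_right)
  next
    case 2
    then show ?thesis
      using False assms
      by (intro that[of "Pmin D i"])
         (auto simp: unit_feasible_def subproblem_objective_def fuel_cost_def distrib_right)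
  qed
qed

lemma optimal_commitment_unit_value:
  assumes "Pmin D i \<le> Pmax D i"
  shows "optimal_commitment D lam i (if unit_value D lam i = 0 then 0 else 1)"
proof -
  obtain p where "unit_feasible D i p (if unit_value D lam i = 0 then 0 else 1)"
    and "subproblem_objective D lam i (p, if unit_value D lam i = 0 then 0 else 1)
           = unit_value D lam i"
    using unit_value_attained[OF assms] .
  then show ?thesis
    unfolding optimal_commitment_def is_arg_min_def
    by (intro exI[of _ p]) (auto simp: not_less intro: unit_value_le)
qed

text \<open>Once the sums over lines and units are exchanged, the multipliers contribute exactly
  \<open>beta D lam i\<close> to the coefficient of \<open>p i\<close>, and the terms free of
  \<open>p\<close> are those of the LP. The vector put in place of \<open>y\<close> need not be
  LP-feasible; only the formula of the objective is used.\<close>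

lemma lagrangian_eq_lp_objective:
  "lagrangian D t lam p z =
     lp_objective D t (lam, \<lambda>i. subproblem_objective D lam i (p i, z i))"
proof -
  have swap: "(\<Sum>i\<in>units D. p i * (\<Sum>l\<in>lines D. c l * GammaU D l i))
      = (\<Sum>l\<in>lines D. c l * (\<Sum>i\<in>units D. p i * GammaU D l i))" for c
    unfolding sum_distrib_left by (subst sum.swap) (simp add: mult.left_commute)
  show ?thesis
    unfolding lagrangian_def lp_objective_def subproblem_objective_def beta_def
      g_plus_def g_minus_def
    by (simp add: sum.distrib swap sum_distrib_left[symmetric] sum_subtractf sum_negf algebra_simps)
qed

lemma lp_objective_mono:
  assumes "\<And>i. i \<in> units D \<Longrightarrow> y i \<le> y' i"
  shows "lp_objective D t (lam, y) \<le> lp_objective D t (lam, y')"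
  using assms by (auto simp: lp_objective_def intro: sum_mono)

lemma dual_fun_eq_lp_objective:
  assumes "\<And>i. i \<in> units D \<Longrightarrow> Pmin D i \<le> Pmax D i"
  shows "dual_fun D t lam = ereal (lp_objective D t (lam, unit_value D lam))"
proof (rule antisym)
  let ?z = "\<lambda>i. if unit_value D lam i = 0 then 0 else 1 :: real"
  \<comment> \<open>The constraints couple no two units, so minimizers chosen unit by unit combine
    into a feasible point of the whole problem.\<close>
  have "\<forall>i\<in>units D. \<exists>p. unit_feasible D i p (?z i) \<and>
      subproblem_objective D lam i (p, ?z i) = unit_value D lam i"
    using unit_value_attained assms by metis
  then obtain p where p: "\<And>i. i \<in> units D \<Longrightarrow> unit_feasible D i (p i) (?z i)"
    and opt: "\<And>i. i \<in> units D \<Longrightarrow> subproblem_objective D lam i (p i, ?z i) = unit_value D lam i"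
    by metis
  have "dual_fun D t lam \<le> ereal (lagrangian D t lam p ?z)"
    unfolding dual_fun_def using p by (intro INF_lower2[of "(p, ?z)"]) auto
  also have "lagrangian D t lam p ?z \<le> lp_objective D t (lam, unit_value D lam)"
    unfolding lagrangian_eq_lp_objective by (rule lp_objective_mono) (simp only: opt order.refl)
  finally show "dual_fun D t lam \<le> ereal (lp_objective D t (lam, unit_value D lam))"
    by simp
next
  show "ereal (lp_objective D t (lam, unit_value D lam)) \<le> dual_fun D t lam"
    unfolding dual_fun_def
    by (auto intro!: INF_greatest lp_objective_mono unit_value_le simp: lagrangian_eq_lp_objective)
qed

lemma lp_objective_le_unit_value:
  assumes "lp_feasible D (lam, y)"
  shows "lp_objective D t (lam, y) \<le> lp_objective D t (lam, unit_value D lam)"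
  using assms by (auto simp: lp_feasible_iff intro: lp_objective_mono)

text \<open>Each \<open>y i\<close> has coefficient 1 in the objective and is constrained separately
  from the other entries, so any slack could be used to raise the objective strictly with
  \<open>lam\<close> unchanged.\<close>

lemma lp_optimal_eq_unit_value:
  assumes "finite (units D)"
    and opt: "is_arg_max (lp_objective D t) (lp_feasible D) (lam, y)"
    and "i \<in> units D"
  shows "y i = unit_value D lam i"
proof (rule ccontr)
  assume "y i \<noteq> unit_value D lam i"
  have feas: "lp_feasible D (lam, y)"
    using opt by (simp add: is_arg_max_def)
  with \<open>y i \<noteq> unit_value D lam i\<close> \<open>i \<in> units D\<close> have "y i < unit_value D lam i"
    by (auto simp: lp_feasible_iff order.not_eq_order_implies_strict)
  \<comment> \<open>All entries are bounded by \<open>unit_value\<close>, and the one at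
    \<open>i\<close> strictly; over a finite set this makes the sums strictly ordered.\<close>
  then have "sum y (units D) < sum (unit_value D lam) (units D)"
    using assms(1,3) feas by (intro sum_strict_mono_ex1) (auto simp: lp_feasible_iff)
  then have "lp_objective D t (lam, y) < lp_objective D t (lam, unit_value D lam)"
    by (simp add: lp_objective_def)
  moreover have "lp_feasible D (lam, unit_value D lam)"
    using feas by (simp add: lp_feasible_iff)
  ultimately show False
    using opt by (auto simp: is_arg_max_def)
qed

theorem mainTheorem2:
  fixes D :: "('i, 'k, 'l, 't) uc_data" and t :: 't
  assumes "finite (units D)" and "finite (loads D)" and "finite (lines D)"
    and "\<And>i. i \<in> units D \<Longrightarrow> 0 \<le> Pmin D i \<and> Pmin D i \<le> Pmax D i"
  shows "(SUP lam\<in>{lam. dual_feasible D lam}. dual_fun D t lam)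
           = (SUP x\<in>{x. lp_feasible D x}. ereal (lp_objective D t x))
       \<and> (\<forall>lam. is_arg_max (dual_fun D t) (dual_feasible D) lam
             \<longleftrightarrow> (\<exists>y. is_arg_max (lp_objective D t) (lp_feasible D) (lam, y)))
       \<and> (\<forall>lam y. is_arg_max (lp_objective D t) (lp_feasible D) (lam, y)
             \<longrightarrow> (\<forall>i\<in>units D. optimal_commitment D lam i (if y i = 0 then 0 else 1)))"
proof (intro conjI allI impI ballI)
  have dual: "dual_fun D t lam = ereal (lp_objective D t (lam, unit_value D lam))" for lam
    using assms(4) by (intro dual_fun_eq_lp_objective) auto
  have feas: "lp_feasible D (lam, unit_value D lam) \<longleftrightarrow> dual_feasible D lam" for lam
    by (simp add: lp_feasible_iff)
  have lp_le: "lp_feasible D (lam, y) \<Longrightarrow> ereal (lp_objective D t (lam, y)) \<le> dual_fun D t lam"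
    for lam y by (simp add: dual lp_objective_le_unit_value)
  show "(SUP lam\<in>{lam. dual_feasible D lam}. dual_fun D t lam)
      = (SUP x\<in>{x. lp_feasible D x}. ereal (lp_objective D t x))" (is "?d = ?lp")
  proof (rule antisym)
    \<comment> \<open>Each \<open>lam\<close> is matched with the LP point
      \<open>(lam, unit_value D lam)\<close>, which has the same value; conversely each LP point is
      dominated by the dual value at its own \<open>lam\<close>.\<close>
    show "?d \<le> ?lp"
      by (rule SUP_mono) (use feas in \<open>auto simp: dual\<close>)
    show "?lp \<le> ?d"
      by (rule SUP_mono) (use lp_le in \<open>auto simp: lp_feasible_iff\<close>)
  qed
  fix lam
  show "is_arg_max (dual_fun D t) (dual_feasible D) lam
      \<longleftrightarrow> (\<exists>y. is_arg_max (lp_objective D t) (lp_feasible D) (lam, y))" (is "?l \<longleftrightarrow> ?r")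
  proof
    assume l: ?l
    \<comment> \<open>The witness for \<open>y\<close> is \<open>unit_value D lam\<close>, where the
      LP objective equals the dual function.\<close>
    have "lp_objective D t (lam', y') \<le> lp_objective D t (lam, unit_value D lam)"
      if "lp_feasible D (lam', y')" for lam' y'
    proof -
      have "dual_feasible D lam'"
        using that by (simp add: lp_feasible_iff)
      then have "dual_fun D t lam' \<le> dual_fun D t lam"
        using l by (auto simp: is_arg_max_def not_less)
      with lp_le[OF that] show ?thesis
        by (simp add: dual)
    qed
    then have "is_arg_max (lp_objective D t) (lp_feasible D) (lam, unit_value D lam)"
      using l feas by (auto simp: is_arg_max_def not_less)
    then show ?r by blast
  next
    assume ?r
    then obtain y where y: "is_arg_max (lp_objective D t) (lp_feasible D) (lam, y)" ..
    have y_feas: "lp_feasible D (lam, y)"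
      using y by (simp add: is_arg_max_def)
    have "dual_fun D t lam' \<le> dual_fun D t lam" if "dual_feasible D lam'" for lam'
    proof -
      \<comment> \<open>The left side is the dual value at \<open>lam'\<close>, while the right side
        is at most the dual value at \<open>lam\<close>.\<close>
      have "lp_objective D t (lam', unit_value D lam') \<le> lp_objective D t (lam, y)"
        using y that feas by (auto simp: is_arg_max_def not_less)
      then show ?thesis
        using lp_le[OF y_feas] by (simp add: dual)
    qed
    then show ?l
      using y_feas by (auto simp: is_arg_max_def not_less lp_feasible_iff)
  qed
  fix y i
  assume "is_arg_max (lp_objective D t) (lp_feasible D) (lam, y)" "i \<in> units D"
  \<comment> \<open>This turns the test \<open>y i = 0\<close> into the test on
    \<open>unit_value\<close>, for which an optimal commitment is already known.\<close>
  then have "y i = unit_value D lam i"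
    using assms(1) by (intro lp_optimal_eq_unit_value)
  then show "optimal_commitment D lam i (if y i = 0 then 0 else 1)"
    using optimal_commitment_unit_value[of D i lam] assms(4)[OF \<open>i \<in> units D\<close>] by simp
qed

end
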